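(* Every properly coloured triangle-free graph of chromatic number $\chi$ contains a rainbow induced subgraph on $\chi$ vertices of chromatic number at most $\log_2\chi+1$.
   Context: Graphs are finite and simple. A proper colouring assigns colours to vertices so that adjacent vertices get distinct colours. A subgraph is rainbow if its vertices receive pairwise distinct colours. *)

theory Defs
  imports Complex_Main "Graph_Theory.Graph_Theory"
begin

text \<open>
  Finite simple graphs are the library's \<^locale>\<open>graph\<close>: finite symmetric digraphs without
  loops and parallel arcs, each undirected edge being a pair of opposite arcs.
\<close>

definition proper_colouring :: "('a,'b) pre_digraph \<Rightarrow> ('a \<Rightarrow> 'c) \<Rightarrow> bool" where
  "proper_colouring G c \<longleftrightarrow> (\<forall>u \<in> verts G. \<forall>v \<in> verts G. u \<rightarrow>\<^bsub>G\<^esub> v \<longrightarrow> c u \<noteq> c v)"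

definition colourable :: "('a,'b) pre_digraph \<Rightarrow> nat \<Rightarrow> bool" where
  "colourable G k \<longleftrightarrow> (\<exists>c :: 'a \<Rightarrow> nat. proper_colouring G c \<and> c ` verts G \<subseteq> {..<k})"

definition chromatic_number :: "('a,'b) pre_digraph \<Rightarrow> nat" where
  "chromatic_number G = (LEAST k. colourable G k)"

text \<open>The minimum in the definition is attained, as the following lemma shows.\<close>

lemma (in digraph) colourable_card_verts: "colourable G (card (verts G))"
proof -
  obtain c :: "'a \<Rightarrow> nat" where c: "bij_betw c (verts G) {0..<card (verts G)}"
    using ex_bij_betw_finite_nat[OF finite_verts] by blast
  have "proper_colouring G c"
    unfolding proper_colouring_def
    using c adj_not_same by (metis bij_betw_imp_inj_on inj_on_eq_iff)
  moreover have "c ` verts G \<subseteq> {..<card (verts G)}"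
    using c by (auto simp: bij_betw_def)
  ultimately show ?thesis unfolding colourable_def by blast
qed

text \<open>In a symmetric loopfree digraph, a closed directed walk of length three is a triangle.\<close>

definition triangle_free :: "('a,'b) pre_digraph \<Rightarrow> bool" where
  "triangle_free G \<longleftrightarrow> \<not> (\<exists>u v w. u \<rightarrow>\<^bsub>G\<^esub> v \<and> v \<rightarrow>\<^bsub>G\<^esub> w \<and> w \<rightarrow>\<^bsub>G\<^esub> u)"

definition rainbow :: "('a \<Rightarrow> 'c) \<Rightarrow> ('a,'b) pre_digraph \<Rightarrow> bool" where
  "rainbow c H \<longleftrightarrow> inj_on c (verts H)"

end

theory Submission
  imports Defs
begin

text \<open>
  In a triangle-free graph neighbourhoods are independent, so deleting the colour class and the
  neighbourhood of a vertex lowers the chromatic number by at most 2. Choosing vertices greedily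
  therefore gives a rainbow independent set \<open>I\<close> of size \<open>\<lceil>\<chi>/2\<rceil>\<close>. Deleting all colour classes
  that meet \<open>I\<close> leaves a graph of chromatic number at least \<open>\<lfloor>\<chi>/2\<rfloor>\<close>, to which one applies
  induction; adding \<open>I\<close> to the resulting set costs one more colour.
\<close>

lemma dominates_induce_subgraph_iff:
  "u \<rightarrow>\<^bsub>G \<restriction> S\<^esub> v \<longleftrightarrow> u \<in> S \<and> v \<in> S \<and> u \<rightarrow>\<^bsub>G\<^esub> v"
  by (auto simp: arcs_ends_def arc_to_ends_def induce_subgraph_def)

text \<open>The subgraph's own arcs are eliminated here: every later colouring argument concerns a
  function on a vertex set and adjacency in \<open>G\<close>.\<close>

lemma colourable_induce_subgraph_iff:
  "colourable (G \<restriction> S) k \<longleftrightarrow>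
    (\<exists>f :: 'a \<Rightarrow> nat. (\<forall>u\<in>S. \<forall>v\<in>S. u \<rightarrow>\<^bsub>G\<^esub> v \<longrightarrow> f u \<noteq> f v) \<and> f ` S \<subseteq> {..<k})"
  for G :: "('a,'b) pre_digraph"
  unfolding colourable_def proper_colouring_def
  by (simp add: dominates_induce_subgraph_iff induce_subgraph_verts cong: ball_cong)

lemma colourable_induce_subgraph_empty: "colourable (G \<restriction> {}) 0"
  by (simp add: colourable_induce_subgraph_iff)

lemma colourable_induce_subgraph_mono:
  assumes "colourable (G \<restriction> S) k" "T \<subseteq> S"
  shows "colourable (G \<restriction> T) k"
proof -
  obtain f :: "'a \<Rightarrow> nat" where
    "\<forall>u\<in>S. \<forall>v\<in>S. u \<rightarrow>\<^bsub>G\<^esub> v \<longrightarrow> f u \<noteq> f v" "f ` S \<subseteq> {..<k}"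
    using assms(1) unfolding colourable_induce_subgraph_iff by blast
  with assms(2) show ?thesis
    unfolding colourable_induce_subgraph_iff by (intro exI[of _ f]) blast
qed

text \<open>Disjoint palettes for the two parts suffice. It is mostly used in reverse: deleting an
  \<open>l\<close>-colourable set lowers the chromatic number by at most \<open>l\<close>.\<close>

lemma colourable_induce_subgraph_Un:
  assumes "colourable (G \<restriction> A) k" "colourable (G \<restriction> B) l"
  shows "colourable (G \<restriction> (A \<union> B)) (k + l)"
proof -
  obtain f :: "'a \<Rightarrow> nat" where
    f: "\<And>u v. u \<in> A \<Longrightarrow> v \<in> A \<Longrightarrow> u \<rightarrow>\<^bsub>G\<^esub> v \<Longrightarrow> f u \<noteq> f v" "\<And>u. u \<in> A \<Longrightarrow> f u < k"
    using assms(1) unfolding colourable_induce_subgraph_iff by blast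
  obtain g :: "'a \<Rightarrow> nat" where
    g: "\<And>u v. u \<in> B \<Longrightarrow> v \<in> B \<Longrightarrow> u \<rightarrow>\<^bsub>G\<^esub> v \<Longrightarrow> g u \<noteq> g v" "\<And>u. u \<in> B \<Longrightarrow> g u < l"
    using assms(2) unfolding colourable_induce_subgraph_iff by blast
  \<comment> \<open>\<open>A\<close> and \<open>B\<close> may overlap; vertices in both keep their
    colour under \<open>f\<close>.\<close>
  let ?h = "\<lambda>u. if u \<in> A then f u else k + g u"
  show ?thesis
    unfolding colourable_induce_subgraph_iff
  proof (intro exI[of _ ?h] conjI ballI impI)
    fix u v assume "u \<in> A \<union> B" "v \<in> A \<union> B" "u \<rightarrow>\<^bsub>G\<^esub> v"
    then show "?h u \<noteq> ?h v"
      using f(1)[of u v] g(1)[of u v] f(2)[of u] f(2)[of v] by auto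
  next
    show "?h ` (A \<union> B) \<subseteq> {..<k + l}"
      using f(2) g(2) by (auto simp: trans_less_add1)
  qed
qed

lemma colourable_induce_subgraph_independent:
  assumes "\<And>u v. u \<in> I \<Longrightarrow> v \<in> I \<Longrightarrow> \<not> u \<rightarrow>\<^bsub>G\<^esub> v"
  shows "colourable (G \<restriction> I) 1"
  unfolding colourable_induce_subgraph_iff
  using assms by (intro exI[of _ "\<lambda>_. 0"]) auto

text \<open>The given colouring \<open>c\<close> is itself proper on these classes; its colours, of
  arbitrary type, only have to be renumbered by a bijection \<open>h\<close>.\<close>

lemma colourable_induce_subgraph_colour_classes:
  assumes "proper_colouring G c" "finite C" "S \<subseteq> verts G"
  shows "colourable (G \<restriction> {v \<in> S. c v \<in> C}) (card C)"
proof -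
  obtain h where h: "bij_betw h C {0..<card C}"
    using ex_bij_betw_finite_nat[OF assms(2)] by blast
  show ?thesis
    unfolding colourable_induce_subgraph_iff
  proof (intro exI[of _ "h \<circ> c"] conjI ballI impI)
    fix u v assume uv: "u \<in> {v \<in> S. c v \<in> C}" "v \<in> {v \<in> S. c v \<in> C}" "u \<rightarrow>\<^bsub>G\<^esub> v"
    then have "c u \<noteq> c v"
      using assms(1,3) unfolding proper_colouring_def by blast
    then show "(h \<circ> c) u \<noteq> (h \<circ> c) v"
      using uv h by (auto simp: bij_betw_def inj_on_eq_iff)
  next
    show "(h \<circ> c) ` {v \<in> S. c v \<in> C} \<subseteq> {..<card C}"
      using h by (auto simp: bij_betw_def)
  qed
qed

text \<open>Non-colourability with \<open>2 * n\<close> colours says that the chromatic number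
  exceeds \<open>2 * n\<close>. Each greedy choice uses up two colours, which leaves room for
  \<open>n + 1\<close> choices.\<close>

lemma rainbow_independent_set:
  assumes "graph G" "triangle_free G" "proper_colouring G c"
    and "S \<subseteq> verts G" "\<not> colourable (G \<restriction> S) (2 * n)"
  shows "\<exists>I \<subseteq> S. inj_on c I \<and> card I = n + 1 \<and> (\<forall>u\<in>I. \<forall>v\<in>I. \<not> u \<rightarrow>\<^bsub>G\<^esub> v)"
  using assms(4,5)
proof (induction n arbitrary: S)
  case 0
  interpret graph G by fact
  from 0 obtain v where "v \<in> S"
    using colourable_induce_subgraph_empty by fastforce
  then show ?case
    using adj_not_same by (intro exI[of _ "{v}"]) auto
next
  case (Suc n)
  interpret graph G by fact
  from Suc.prems have "S \<noteq> {}"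
    using colourable_induce_subgraph_mono colourable_induce_subgraph_iff by fastforce
  then obtain v where v: "v \<in> S" by blast
  \<comment> \<open>\<open>K\<close> contains \<open>v\<close> itself. \<open>N\<close> is taken in
    all of \<open>G\<close> and may leave \<open>S\<close>, so removing both parts and adding them
    back gives only a superset of \<open>S\<close>.\<close>
  define K where "K = {u \<in> S. c u \<in> {c v}}"
  define N where "N = {u. v \<rightarrow>\<^bsub>G\<^esub> u}"
  define S' where "S' = S - (K \<union> N)"
  have "colourable (G \<restriction> K) 1"
    unfolding K_def
    using colourable_induce_subgraph_colour_classes[OF assms(3), of "{c v}" S] Suc.prems(1)
    by simp
  moreover have "colourable (G \<restriction> N) 1"
  proof (rule colourable_induce_subgraph_independent)
    fix u w assume "u \<in> N" "w \<in> N"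
    then have "v \<rightarrow>\<^bsub>G\<^esub> u" "w \<rightarrow>\<^bsub>G\<^esub> v"
      using arcs_ends_symmetric[OF sym_arcs] by (simp_all add: N_def)
    \<comment> \<open>An arc from \<open>u\<close> to \<open>w\<close> would close the walk
      \<open>v\<close>, \<open>u\<close>, \<open>w\<close>, \<open>v\<close>.\<close>
    then show "\<not> u \<rightarrow>\<^bsub>G\<^esub> w"
      using assms(2) unfolding triangle_free_def by blast
  qed
  ultimately have KN: "colourable (G \<restriction> (K \<union> N)) 2"
    using colourable_induce_subgraph_Un[of G K 1 N 1] by (simp add: numeral_2_eq_2)
  have "\<not> colourable (G \<restriction> S') (2 * n)"
  proof
    assume "colourable (G \<restriction> S') (2 * n)"
    from colourable_induce_subgraph_Un[OF this KN]
    have "colourable (G \<restriction> (S' \<union> (K \<union> N))) (2 * Suc n)" by simp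
    then have "colourable (G \<restriction> S) (2 * Suc n)"
      by (rule colourable_induce_subgraph_mono) (auto simp: S'_def)
    with Suc.prems(2) show False by contradiction
  qed
  then obtain I where I: "I \<subseteq> S'" "inj_on c I" "card I = n + 1"
      "\<forall>u\<in>I. \<forall>w\<in>I. \<not> u \<rightarrow>\<^bsub>G\<^esub> w"
    using Suc.IH[of S'] Suc.prems(1) by (auto simp: S'_def)
  have new: "v \<notin> I" "c v \<notin> c ` I"
    using I(1) v by (auto simp: S'_def K_def)
  have nonadj: "\<not> v \<rightarrow>\<^bsub>G\<^esub> u" "\<not> u \<rightarrow>\<^bsub>G\<^esub> v" if "u \<in> I" for u
  proof -
    show "\<not> v \<rightarrow>\<^bsub>G\<^esub> u" using that I(1) by (auto simp: S'_def N_def)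
    then show "\<not> u \<rightarrow>\<^bsub>G\<^esub> v" using arcs_ends_symmetric[OF sym_arcs] by blast
  qed
  have "finite I"
    using I(3) by (simp add: card_ge_0_finite)
  show ?case
  proof (intro exI[of _ "insert v I"] conjI)
    show "insert v I \<subseteq> S" using I(1) v by (auto simp: S'_def)
    show "inj_on c (insert v I)" using I(2) new by auto
    show "card (insert v I) = Suc n + 1" using I(3) new \<open>finite I\<close> by simp
    show "\<forall>u\<in>insert v I. \<forall>w\<in>insert v I. \<not> u \<rightarrow>\<^bsub>G\<^esub> w"
      using I(4) nonadj adj_not_same by auto
  qed
qed

text \<open>Only a lower bound \<open>k\<close> on the chromatic number of \<open>S\<close> is
  assumed, so the induction can pass to a subset whose exact chromatic number is unknown. The bound
  on \<open>l\<close> is the logarithmic one in integer form; the alternative \<open>l = 0\<close>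
  covers \<open>k = 0\<close>.\<close>

lemma rainbow_set_few_colours:
  assumes "graph G" "triangle_free G" "proper_colouring G c"
    and "S \<subseteq> verts G" "\<And>j. j < k \<Longrightarrow> \<not> colourable (G \<restriction> S) j"
  shows "\<exists>T \<subseteq> S. \<exists>l. inj_on c T \<and> card T = k \<and> colourable (G \<restriction> T) l \<and> (l = 0 \<or> 2 ^ l \<le> 2 * k)"
  using assms(4,5)
proof (induction k arbitrary: S rule: less_induct)
  case (less k)
  interpret graph G by fact
  show ?case
  proof (cases "k = 0")
    case True
    then show ?thesis
      using colourable_induce_subgraph_empty by (intro exI[of _ "{}"] conjI exI[of _ 0]) auto
  next
    case False
    \<comment> \<open>The independent set gets the larger half \<open>k - h\<close>, the recursion
      the smaller half \<open>h\<close>. For either parity \<open>2 * (k - h - 1)\<close> is still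
      below \<open>k\<close>.\<close>
    define h where "h = k div 2"
    have "2 * (k - h - 1) < k" using False by (simp add: h_def)
    then have "\<not> colourable (G \<restriction> S) (2 * (k - h - 1))" by (rule less.prems(2))
    from rainbow_independent_set[OF assms(1-3) less.prems(1) this]
    obtain I where I: "I \<subseteq> S" "inj_on c I" "card I = k - h"
        "\<forall>u\<in>I. \<forall>v\<in>I. \<not> u \<rightarrow>\<^bsub>G\<^esub> v"
      using False by (auto simp: h_def)
    have "finite I" using I(1) less.prems(1) finite_verts by (meson finite_subset)
    define K where "K = {v \<in> S. c v \<in> c ` I}"
    have K: "colourable (G \<restriction> K) (k - h)"
      using colourable_induce_subgraph_colour_classes[OF assms(3) _ less.prems(1), of "c ` I"]
        \<open>finite I\<close> I(2,3) by (simp add: K_def card_image)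
    \<comment> \<open>Since \<open>I\<close> is rainbow, \<open>K\<close> consists of exactly
      \<open>k - h\<close> colour classes, so at least \<open>h\<close> colours are needed outside
      it.\<close>
    have "\<not> colourable (G \<restriction> (S - K)) j" if "j < h" for j
    proof
      assume "colourable (G \<restriction> (S - K)) j"
      from colourable_induce_subgraph_Un[OF this K]
      have "colourable (G \<restriction> S) (j + (k - h))"
        by (rule colourable_induce_subgraph_mono) auto
      moreover have "j + (k - h) < k" using that by (simp add: h_def)
      ultimately show False using less.prems(2) by blast
    qed
    moreover have "h < k" using False by (simp add: h_def)
    ultimately obtain T l where T: "T \<subseteq> S - K" "inj_on c T" "card T = h"
        "colourable (G \<restriction> T) l" "l = 0 \<or> 2 ^ l \<le> 2 * h"
      using less.IH[of h "S - K"] less.prems(1) by blast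
    have "finite T" using T(1) less.prems(1) finite_verts by (meson Diff_subset finite_subset)
    \<comment> \<open>All vertices sharing a colour with \<open>I\<close> lie in \<open>K\<close>.
      This makes the union rainbow and also makes \<open>T\<close> and \<open>I\<close>
      disjoint.\<close>
    have disj: "c ` T \<inter> c ` I = {}" using T(1) by (auto simp: K_def)
    show ?thesis
    proof (intro exI[of _ "T \<union> I"] exI[of _ "l + 1"] conjI)
      show "T \<union> I \<subseteq> S" using T(1) I(1) by auto
      show "inj_on c (T \<union> I)" using T(2) I(2) disj by (auto simp: inj_on_Un)
      have "T \<inter> I = {}" using disj by auto
      then show "card (T \<union> I) = k"
        using \<open>finite I\<close> \<open>finite T\<close> I(3) T(3) \<open>h < k\<close> by (simp add: card_Un_disjoint)
      show "colourable (G \<restriction> (T \<union> I)) (l + 1)"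
        using I(4) T(4)
        by (blast intro: colourable_induce_subgraph_Un colourable_induce_subgraph_independent)
      \<comment> \<open>If \<open>l = 0\<close>, this is \<open>k\<close> \<ge> 1; otherwise
        doubling the bound for \<open>h\<close> gives at most \<open>4 * h\<close>, and
        \<open>2 * h\<close> \<le> \<open>k\<close>.\<close>
      show "l + 1 = 0 \<or> 2 ^ (l + 1) \<le> 2 * k"
        using T(5) False by (auto simp: h_def)
    qed
  qed
qed

theorem theorem11:
  fixes G :: "('a,'b) pre_digraph" and c :: "'a \<Rightarrow> 'c"
  assumes "graph G"
    and "triangle_free G"
    and "proper_colouring G c"
  shows "\<exists>H. induced_subgraph H G \<and> rainbow c H
           \<and> card (verts H) = chromatic_number G
           \<and> real (chromatic_number H) \<le> log 2 (real (chromatic_number G)) + 1"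
proof -
  interpret graph G by fact
  define k where "k = chromatic_number G"
  have "\<not> colourable (G \<restriction> verts G) j" if "j < k" for j
  proof -
    have "\<not> colourable G j"
      using not_less_Least that unfolding k_def chromatic_number_def by blast
    then show ?thesis
      \<comment> \<open>Inducing on all of \<open>verts G\<close> leaves the condition on colourings
        unchanged.\<close>
      by (simp add: colourable_induce_subgraph_iff) (simp add: colourable_def proper_colouring_def)
  qed
  from rainbow_set_few_colours[OF assms order_refl this]
  obtain T l where T: "T \<subseteq> verts G" "inj_on c T" "card T = k"
      "colourable (G \<restriction> T) l" "l = 0 \<or> 2 ^ l \<le> 2 * k"
    by blast
  have l: "real l \<le> log 2 (real k) + 1"
  proof (cases "k = 0")
    case True
    \<comment> \<open>here \<open>log 2 0 = 0\<close>\<close>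
    then show ?thesis using T(5) by (auto simp: log_def)
  next
    case False
    have "2 ^ l \<le> 2 * k" using T(5) False by auto
    then have "real (2 ^ l) \<le> real (2 * k)" by (simp only: of_nat_le_iff)
    then have "real l \<le> log 2 (2 * real k)"
      using False by (simp add: le_log_iff powr_realpow)
    then show ?thesis using False by (simp add: log_mult)
  qed
  have "chromatic_number (G \<restriction> T) \<le> l"
    unfolding chromatic_number_def using T(4) by (rule Least_le)
  then have "real (chromatic_number (G \<restriction> T)) \<le> log 2 (real k) + 1"
    using l by linarith
  then show ?thesis
    using T induced_induce[OF T(1)]
    by (intro exI[of _ "G \<restriction> T"]) (auto simp: rainbow_def k_def)
qed

end
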